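(* Let $S=\mathcal{M}[G;I,\Lambda;P]$ be a completely simple semigroup with $|S|\ge 2$. Then $S$ is right uniform if and only if either ($|I|=2$, $|\Lambda|=1$ and $G$ is a trivial group) or $|I|=1$; equivalently, $S$ is right uniform if and only if $S$ is a left zero semigroup with two elements or $S$ is a right group.
   Context: A right $S$-act is a nonempty set $A$ with a map $A\times S\to A$, $(a,s)\mapsto as$, with $a(st)=(as)t$. A subact is a nonempty subset closed under the action; an $S$-homomorphism is a map $f$ with $f(as)=f(a)s$. A subact is nonzero if it is not a one-element subact. A subact $B$ of $A$ is large in $A$ if every $S$-homomorphism $g:A\to C$ (for any right $S$-act $C$) whose restriction to $B$ is injective is itself injective. A right $S$-act is uniform if every nonzero subact is large in it. A semigroup $S$ is right uniform if the right $S$-act $S_S$ ($S$ acting on itself by right multiplication; its subacts are the nonempty right ideals) is uniform. $\mathcal{M}[G;I,\Lambda;P]$ is the Rees matrix semigroup: $G$ is a group, $I,\Lambda$ are nonempty sets, $P=(p_{\lambda i})$ is a $\Lambda\times I$ matrix with entries in $G$, the underlying set is $I\times G\times\Lambda$, and $(i,g,\lambda)(j,h,\mu)=(i,g\,p_{\lambda j}h,\mu)$. A left zero semigroup satisfies $xy=x$ for all $x,y$. A right group is a semigroup that is right simple (its only right ideal is itself) and left cancellative. *)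

theory Defs
  imports "HOL-Algebra.Elementary_Groups"
begin

record 's sgroup = "'s partial_object" +
  sop :: "'s \<Rightarrow> 's \<Rightarrow> 's" (infixl "\<cdot>\<index>" 70)

definition is_semigroup :: "'s sgroup \<Rightarrow> bool" where
  "is_semigroup S \<longleftrightarrow> carrier S \<noteq> {} \<and>
     (\<forall>x\<in>carrier S. \<forall>y\<in>carrier S. x \<cdot>\<^bsub>S\<^esub> y \<in> carrier S) \<and>
     (\<forall>x\<in>carrier S. \<forall>y\<in>carrier S. \<forall>z\<in>carrier S.
        (x \<cdot>\<^bsub>S\<^esub> y) \<cdot>\<^bsub>S\<^esub> z = x \<cdot>\<^bsub>S\<^esub> (y \<cdot>\<^bsub>S\<^esub> z))"

record ('a, 's) ract = "'a partial_object" +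
  action :: "'a \<Rightarrow> 's \<Rightarrow> 'a"

definition right_act :: "'s sgroup \<Rightarrow> ('a, 's) ract \<Rightarrow> bool" where
  "right_act S A \<longleftrightarrow> is_semigroup S \<and> carrier A \<noteq> {} \<and>
     (\<forall>a\<in>carrier A. \<forall>s\<in>carrier S. action A a s \<in> carrier A) \<and>
     (\<forall>a\<in>carrier A. \<forall>s\<in>carrier S. \<forall>t\<in>carrier S.
        action A a (s \<cdot>\<^bsub>S\<^esub> t) = action A (action A a s) t)"

definition subact :: "'s sgroup \<Rightarrow> ('a, 's) ract \<Rightarrow> 'a set \<Rightarrow> bool" where
  "subact S A B \<longleftrightarrow> B \<noteq> {} \<and> B \<subseteq> carrier A \<and>
     (\<forall>b\<in>B. \<forall>s\<in>carrier S. action A b s \<in> B)"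

definition nonzero_subact :: "'s sgroup \<Rightarrow> ('a, 's) ract \<Rightarrow> 'a set \<Rightarrow> bool" where
  "nonzero_subact S A B \<longleftrightarrow> subact S A B \<and> \<not> is_singleton B"

definition act_hom :: "'s sgroup \<Rightarrow> ('a, 's) ract \<Rightarrow> ('c, 's) ract \<Rightarrow> ('a \<Rightarrow> 'c) set" where
  "act_hom S A C = {g. (\<forall>a\<in>carrier A. g a \<in> carrier C) \<and>
     (\<forall>a\<in>carrier A. \<forall>s\<in>carrier S. g (action A a s) = action C (g a) s)}"

text \<open>HOL cannot quantify over the element type of \<open>C\<close> inside a definition, so \<open>C\<close> ranges over
  acts whose elements have the same type as those of \<open>A\<close>. This loses nothing: the image of a
  homomorphism out of \<open>A\<close> can be copied onto a set of representatives in \<open>A\<close>. Theorem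
  \<open>large_any_codomain\<close> below proves that the property then holds for acts \<open>C\<close> over every type.\<close>

definition large :: "'s sgroup \<Rightarrow> ('a, 's) ract \<Rightarrow> 'a set \<Rightarrow> bool" where
  "large S A B \<longleftrightarrow> subact S A B \<and>
     (\<forall>(C :: ('a, 's) ract) g. right_act S C \<longrightarrow> g \<in> act_hom S A C \<longrightarrow>
        inj_on g B \<longrightarrow> inj_on g (carrier A))"

definition uniform_act :: "'s sgroup \<Rightarrow> ('a, 's) ract \<Rightarrow> bool" where
  "uniform_act S A \<longleftrightarrow> right_act S A \<and> (\<forall>B. nonzero_subact S A B \<longrightarrow> large S A B)"

definition self_act :: "'s sgroup \<Rightarrow> ('s, 's) ract" where
  "self_act S = \<lparr>carrier = carrier S, action = sop S\<rparr>"

definition right_uniform :: "'s sgroup \<Rightarrow> bool" where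
  "right_uniform S \<longleftrightarrow> is_semigroup S \<and> uniform_act S (self_act S)"

definition left_zero_semigroup :: "'s sgroup \<Rightarrow> bool" where
  "left_zero_semigroup S \<longleftrightarrow> is_semigroup S \<and>
     (\<forall>x\<in>carrier S. \<forall>y\<in>carrier S. x \<cdot>\<^bsub>S\<^esub> y = x)"

definition right_ideal :: "'s sgroup \<Rightarrow> 's set \<Rightarrow> bool" where
  "right_ideal S R \<longleftrightarrow> R \<noteq> {} \<and> R \<subseteq> carrier S \<and>
     (\<forall>r\<in>R. \<forall>s\<in>carrier S. r \<cdot>\<^bsub>S\<^esub> s \<in> R)"

definition right_simple :: "'s sgroup \<Rightarrow> bool" where
  "right_simple S \<longleftrightarrow> (\<forall>R. right_ideal S R \<longrightarrow> R = carrier S)"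

definition left_cancellative :: "'s sgroup \<Rightarrow> bool" where
  "left_cancellative S \<longleftrightarrow> (\<forall>x\<in>carrier S. \<forall>y\<in>carrier S. \<forall>z\<in>carrier S.
     x \<cdot>\<^bsub>S\<^esub> y = x \<cdot>\<^bsub>S\<^esub> z \<longrightarrow> y = z)"

definition right_group :: "'s sgroup \<Rightarrow> bool" where
  "right_group S \<longleftrightarrow> is_semigroup S \<and> right_simple S \<and> left_cancellative S"

definition rees_matrix ::
    "('g, 'm) monoid_scheme \<Rightarrow> 'i set \<Rightarrow> 'l set \<Rightarrow> ('l \<Rightarrow> 'i \<Rightarrow> 'g) \<Rightarrow> ('i \<times> 'g \<times> 'l) sgroup" where
  "rees_matrix G I \<Lambda> P =
     \<lparr>carrier = I \<times> carrier G \<times> \<Lambda>,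
      sop = (\<lambda>(i, g, l) (j, h, m). (i, g \<otimes>\<^bsub>G\<^esub> P l j \<otimes>\<^bsub>G\<^esub> h, m))\<rparr>"

theorem large_any_codomain:
  fixes S :: "'s sgroup" and A :: "('a, 's) ract" and C :: "('c, 's) ract"
  assumes A: "right_act S A" and B: "large S A B" and C: "right_act S C"
    and g: "g \<in> act_hom S A C" and inj: "inj_on g B"
  shows "inj_on g (carrier A)"
proof -
  define r where "r = inv_into (carrier A) g"
  define D :: "('a, 's) ract" where
    "D = \<lparr>carrier = r ` g ` carrier A, action = (\<lambda>x s. r (g (action A x s)))\<rparr>"
  have rA: "r (g x) \<in> carrier A" and gr: "g (r (g x)) = g x" if "x \<in> carrier A" for x
    using that unfolding r_def by (auto intro: inv_into_into f_inv_into_f)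
  have cl: "action A x s \<in> carrier A" if "x \<in> carrier A" "s \<in> carrier S" for x s
    using A that by (auto simp: right_act_def)
  have hom: "g (action A x s) = action C (g x) s" if "x \<in> carrier A" "s \<in> carrier S" for x s
    using g that by (auto simp: act_hom_def)
  have key: "g (action A (r (g x)) s) = g (action A x s)"
    if "x \<in> carrier A" "s \<in> carrier S" for x s
    using that by (simp add: hom rA gr)
  have key2: "g (action A (action A (r (g x)) s) t) = g (action A (action A x s) t)"
    if "x \<in> carrier A" "s \<in> carrier S" "t \<in> carrier S" for x s t
    using that by (simp add: hom rA gr cl)
  have assoc: "action A x (s \<cdot>\<^bsub>S\<^esub> t) = action A (action A x s) t"
    and S: "s \<cdot>\<^bsub>S\<^esub> t \<in> carrier S"
    if "x \<in> carrier A" "s \<in> carrier S" "t \<in> carrier S" for x s t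
    using A that by (auto simp: right_act_def is_semigroup_def)
  have D: "right_act S D"
    using A by (auto simp: right_act_def D_def key key2 cl rA assoc S)
  have "r \<circ> g \<in> act_hom S A D"
    by (auto simp: act_hom_def D_def key)
  moreover have "inj_on (r \<circ> g) B"
  proof (rule comp_inj_on[OF inj])
    have "B \<subseteq> carrier A" using B by (auto simp: large_def subact_def)
    then show "inj_on r (g ` B)" by (metis r_def image_mono inj_on_inv_into)
  qed
  ultimately have "inj_on (r \<circ> g) (carrier A)"
    using B D unfolding large_def by blast
  then show ?thesis by (rule inj_on_imageI2)
qed

lemma rees_matrix_is_semigroup:
  assumes "group G" "I \<noteq> {}" "\<Lambda> \<noteq> {}" "\<And>l i. l \<in> \<Lambda> \<Longrightarrow> i \<in> I \<Longrightarrow> P l i \<in> carrier G"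
  shows "is_semigroup (rees_matrix G I \<Lambda> P)"
proof -
  interpret group G by fact
  have "carrier G \<noteq> {}" by blast
  then show ?thesis
    using assms by (auto simp: is_semigroup_def rees_matrix_def m_assoc)
qed

end

theory Submission imports Defs begin

text \<open>For \<open>J \<subseteq> I\<close> nonempty, \<open>J \<times> G \<times> \<Lambda>\<close> is a right ideal of the Rees matrix semigroup, and moving
  all first coordinates outside \<open>J\<close> to a fixed element of \<open>J\<close> is a right \<open>S\<close>-homomorphism that is
  injective on this ideal. So if \<open>S\<close> is right uniform, then \<open>J \<times> G \<times> \<Lambda>\<close> is a single element for
  every proper nonempty \<open>J\<close>; taking \<open>J\<close> of size one and two gives the classification.\<close>

locale rees = group G for G :: "('g, 'm) monoid_scheme" (structure) +
  fixes I :: "'i set" and \<Lambda> :: "'l set" and P :: "'l \<Rightarrow> 'i \<Rightarrow> 'g"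
  assumes I_nonempty: "I \<noteq> {}" and \<Lambda>_nonempty: "\<Lambda> \<noteq> {}"
    and P_closed: "l \<in> \<Lambda> \<Longrightarrow> i \<in> I \<Longrightarrow> P l i \<in> carrier G"
begin

abbreviation "S \<equiv> rees_matrix G I \<Lambda> P"

lemma carrier_rees: "carrier S = I \<times> carrier G \<times> \<Lambda>"
  by (simp add: rees_matrix_def)

lemma sop_rees: "(i, g, l) \<cdot>\<^bsub>S\<^esub> (j, h, m) = (i, g \<otimes> P l j \<otimes> h, m)"
  by (simp add: rees_matrix_def)

lemma semigroup_rees: "is_semigroup S"
  by (intro rees_matrix_is_semigroup is_group I_nonempty \<Lambda>_nonempty P_closed)

lemma right_act_self: "right_act S (self_act S)"
  using semigroup_rees by (auto simp: right_act_def self_act_def is_semigroup_def)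

lemma subact_self_iff_right_ideal: "subact S (self_act S) B \<longleftrightarrow> right_ideal S B"
  by (simp add: subact_def right_ideal_def self_act_def)

lemma right_ideal_rows:
  assumes "J \<noteq> {}" "J \<subseteq> I"
  shows "right_ideal S (J \<times> carrier G \<times> \<Lambda>)"
  using assms \<Lambda>_nonempty P_closed
  by (auto simp: right_ideal_def carrier_rees sop_rees)

text \<open>Since \<open>P l i\<close> is a group element, the equation
  \<open>g \<otimes> P l i \<otimes> y = h\<close> is solvable for \<open>y\<close>, and the last
  coordinate of the right factor is free. So one element of a row generates the whole row, and right
  ideals are unions of rows.\<close>

lemma right_ideal_row_subset:
  assumes R: "right_ideal S R" and mem: "(i, g, l) \<in> R"
  shows "{i} \<times> carrier G \<times> \<Lambda> \<subseteq> R"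
proof (intro subsetI)
  fix x assume "x \<in> {i} \<times> carrier G \<times> \<Lambda>"
  then obtain h m where x: "x = (i, h, m)" "h \<in> carrier G" "m \<in> \<Lambda>" by auto
  have igl: "i \<in> I" "g \<in> carrier G" "l \<in> \<Lambda>"
    using R mem by (auto simp: right_ideal_def carrier_rees)
  let ?u = "g \<otimes> P l i"
  have u: "?u \<in> carrier G" using igl P_closed by simp
  have "(i, g, l) \<cdot>\<^bsub>S\<^esub> (i, inv ?u \<otimes> h, m) \<in> R"
    using R mem igl x u by (simp add: right_ideal_def carrier_rees)
  moreover have "?u \<otimes> (inv ?u \<otimes> h) = h"
    using u x by (simp add: m_assoc[symmetric])
  ultimately show "x \<in> R" by (simp add: sop_rees x)
qed

lemma right_simple_iff: "right_simple S \<longleftrightarrow> card I = 1"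
proof
  assume *: "right_simple S"
  obtain i where i: "i \<in> I" using I_nonempty by blast
  then have "right_ideal S ({i} \<times> carrier G \<times> \<Lambda>)" by (intro right_ideal_rows) auto
  with * have "{i} \<times> carrier G \<times> \<Lambda> = I \<times> carrier G \<times> \<Lambda>"
    unfolding right_simple_def carrier_rees by blast
  then have "I = {i}" using \<Lambda>_nonempty one_closed by auto
  then show "card I = 1" by simp
next
  assume "card I = 1"
  then obtain i where I: "I = {i}" by (auto simp: card_1_singleton_iff)
  show "right_simple S" unfolding right_simple_def
  proof (intro allI impI)
    fix R assume R: "right_ideal S R"
    then obtain x where x: "x \<in> R" by (auto simp: right_ideal_def)
    obtain k g l where x_eq: "x = (k, g, l)" by (cases x)
    have "R \<subseteq> {i} \<times> carrier G \<times> \<Lambda>"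
      using R unfolding right_ideal_def carrier_rees by (simp add: I)
    with x have "(i, g, l) \<in> R" by (auto simp: x_eq)
    from right_ideal_row_subset[OF R this] \<open>R \<subseteq> _\<close> show "R = carrier S"
      unfolding carrier_rees by (simp add: I subset_antisym)
  qed
qed

text \<open>In a single row, left cancellation comes for free: a product keeps the last coordinate
  of its right factor and multiplies the middle one on the left by a fixed group element.\<close>

lemma right_group_iff: "right_group S \<longleftrightarrow> card I = 1"
proof
  assume I: "card I = 1"
  have "left_cancellative S"
    using I P_closed by (auto simp: left_cancellative_def carrier_rees sop_rees card_1_singleton_iff)
  then show "right_group S"
    using I semigroup_rees by (simp add: right_group_def right_simple_iff)
qed (simp add: right_group_def right_simple_iff)

lemma left_zero_iff: "left_zero_semigroup S \<longleftrightarrow> card \<Lambda> = 1 \<and> trivial_group G"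
proof
  assume *: "left_zero_semigroup S"
  obtain i l where il: "i \<in> I" "l \<in> \<Lambda>" using I_nonempty \<Lambda>_nonempty by blast
  have prod: "(i, g \<otimes> P l i \<otimes> h, m) = (i, g, l)"
    if "g \<in> carrier G" "h \<in> carrier G" "m \<in> \<Lambda>" for g h m
    using * that il unfolding left_zero_semigroup_def sop_rees[symmetric] carrier_rees by blast
  then have "\<Lambda> = {l}" using il one_closed by blast
  moreover have "h = \<one>" if h: "h \<in> carrier G" for h
  proof -
    \<comment> \<open>The left factor is chosen to cancel the sandwich entry, so the middle
      coordinate of the product is just \<open>h\<close>. Comparing with the same equation for the
      identity gives the claim.\<close>
    have "inv (P l i) \<otimes> P l i \<otimes> h = inv (P l i)"
      using prod[of "inv (P l i)" h l] h il P_closed by simp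
    moreover have "inv (P l i) \<otimes> P l i \<otimes> \<one> = inv (P l i)"
      using prod[of "inv (P l i)" \<one> l] il P_closed by simp
    ultimately show ?thesis using h il P_closed by simp
  qed
  then have "carrier G = {\<one>}" by blast
  ultimately show "card \<Lambda> = 1 \<and> trivial_group G"
    by (simp add: trivial_group_def is_group)
next
  assume "card \<Lambda> = 1 \<and> trivial_group G"
  then show "left_zero_semigroup S"
    using semigroup_rees P_closed
    by (fastforce simp: left_zero_semigroup_def carrier_rees sop_rees card_1_singleton_iff
        trivial_group_def)
qed

text \<open>Links the two forms of the classification: once the other two factors of the carrier are
  singletons, its cardinality is that of \<open>I\<close>.\<close>

lemma left_zero_card_2_iff:
  "left_zero_semigroup S \<and> card (carrier S) = 2 \<longleftrightarrow>
     card I = 2 \<and> card \<Lambda> = 1 \<and> trivial_group G"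
  by (auto simp: left_zero_iff carrier_rees card_cartesian_product trivial_group_def)

lemma right_uniform_imp_singleton_rows:
  assumes unif: "right_uniform S" and J: "J \<noteq> {}" "J \<subset> I"
  shows "is_singleton (J \<times> carrier G \<times> \<Lambda>)"
proof (rule ccontr)
  let ?B = "J \<times> carrier G \<times> \<Lambda>"
  assume "\<not> is_singleton ?B"
  then have "nonzero_subact S (self_act S) ?B"
    using J right_ideal_rows by (simp add: nonzero_subact_def subact_self_iff_right_ideal)
  then have large: "large S (self_act S) ?B"
    using unif by (simp add: right_uniform_def uniform_act_def)
  obtain j k where jk: "j \<in> J" "k \<in> I" "k \<notin> J" using J by blast
  define r where "r i = (if i \<in> J then i else j)" for i
  define f :: "'i \<times> 'g \<times> 'l \<Rightarrow> 'i \<times> 'g \<times> 'l" where "f = map_prod r id"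
  have f: "f (i, y) = (r i, y)" for i y by (simp add: f_def)
  \<comment> \<open>Right multiplication keeps the first coordinate of the left factor, and the
    other coordinates of the product do not depend on it. Hence any relabelling of rows commutes
    with the action.\<close>
  have "f \<in> act_hom S (self_act S) (self_act S)"
    using J jk by (auto simp: act_hom_def self_act_def carrier_rees sop_rees f r_def)
  moreover have "inj_on f ?B"
    by (auto simp: inj_on_def f r_def)
  ultimately have inj: "inj_on f (carrier S)"
    using large right_act_self unfolding large_def by (auto simp: self_act_def)
  obtain l where l: "l \<in> \<Lambda>" using \<Lambda>_nonempty by blast
  \<comment> \<open>Row \<open>k\<close> is folded onto row \<open>j\<close>, so these two elements
    have the same image under \<open>f\<close>.\<close>
  have "(j, \<one>, l) = (k, \<one>, l)"
    by (rule inj_onD[OF inj]) (use jk J l in \<open>auto simp: f r_def carrier_rees\<close>)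
  then show False using jk by simp
qed

lemma right_uniform_iff:
  "right_uniform S \<longleftrightarrow> (card I = 2 \<and> card \<Lambda> = 1 \<and> trivial_group G) \<or> card I = 1"
proof
  assume unif: "right_uniform S"
  show "(card I = 2 \<and> card \<Lambda> = 1 \<and> trivial_group G) \<or> card I = 1"
  proof (cases "card I = 1")
    \<comment> \<open>This case includes infinite \<open>I\<close>, whose \<open>card\<close> is 0,
      so the argument works with two distinct elements instead of cardinalities.\<close>
    case False
    obtain i where i: "i \<in> I" using I_nonempty by blast
    with False obtain j where j: "j \<in> I" "j \<noteq> i"
      by (metis card_1_singleton_iff One_nat_def empty_iff insertI1 singletonD subsetI subset_antisym
          subset_singletonD)
    have "is_singleton ({i} \<times> carrier G \<times> \<Lambda>)"
      using i j by (intro right_uniform_imp_singleton_rows unif) auto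
    then have uniq: "x = y" if "x \<in> {i} \<times> carrier G \<times> \<Lambda>" "y \<in> {i} \<times> carrier G \<times> \<Lambda>" for x y
      using that by (metis is_singletonE singletonD)
    obtain l where l: "l \<in> \<Lambda>" using \<Lambda>_nonempty by blast
    have "g = \<one>" if "g \<in> carrier G" for g
      using uniq[of "(i, g, l)" "(i, \<one>, l)"] that l by simp
    then have "carrier G = {\<one>}" by blast
    moreover have "m = l" if "m \<in> \<Lambda>" for m
      using uniq[of "(i, \<one>, m)" "(i, \<one>, l)"] that l by simp
    then have "\<Lambda> = {l}" using l by blast
    \<comment> \<open>A third index would make \<open>{i, j}\<close> a proper subset of
      \<open>I\<close>, yet its block of rows contains two distinct elements.\<close>
    moreover have "I = {i, j}"
    proof (rule ccontr)
      assume "I \<noteq> {i, j}"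
      then have "is_singleton ({i, j} \<times> carrier G \<times> \<Lambda>)"
        using i j by (intro right_uniform_imp_singleton_rows unif) auto
      then obtain x where x: "{i, j} \<times> carrier G \<times> \<Lambda> = {x}"
        by (elim is_singletonE)
      have "(i, \<one>, l) \<in> {x}" "(j, \<one>, l) \<in> {x}"
        unfolding x[symmetric] using l by simp_all
      then show False using j by blast
    qed
    ultimately show ?thesis using j by (simp add: trivial_group_def is_group)
  qed simp
next
  assume *: "(card I = 2 \<and> card \<Lambda> = 1 \<and> trivial_group G) \<or> card I = 1"
  \<comment> \<open>For the converse there is no proper nonzero right ideal at all: either
    \<open>S\<close> is right simple, or it has just two elements. Injectivity on \<open>B\<close>
    is then already injectivity on \<open>S\<close>.\<close>
  have full: "B = carrier S" if B: "nonzero_subact S (self_act S) B" for B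
  proof (cases "card I = 1")
    case True
    then show ?thesis
      using B right_simple_iff
      by (auto simp: nonzero_subact_def subact_self_iff_right_ideal right_simple_def)
  next
    case False
    with * have card: "card (carrier S) = 2" using left_zero_card_2_iff by blast
    then have fin: "finite (carrier S)" by (simp add: card_ge_0_finite)
    have sub: "B \<subseteq> carrier S" "B \<noteq> {}" "card B \<noteq> 1"
      using B by (auto simp: nonzero_subact_def subact_def self_act_def is_singleton_altdef)
    \<comment> \<open>Finiteness is needed to exclude \<open>card B = 0\<close>, which an infinite
      set would also have. With size 1 excluded too, \<open>B\<close> has at least two
      elements.\<close>
    then have "finite B" using fin finite_subset by blast
    then have "card B \<noteq> 0" using sub by simp
    then have "card (carrier S) \<le> card B" using sub card by linarith
    then show ?thesis using card_seteq[OF fin sub(1)] by blast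
  qed
  have "large S (self_act S) B" if "nonzero_subact S (self_act S) B" for B
    using that full[OF that] by (simp add: large_def nonzero_subact_def self_act_def)
  then show "right_uniform S"
    by (simp add: right_uniform_def uniform_act_def semigroup_rees right_act_self)
qed

end

theorem corollary3p10:
  fixes G :: "('g, 'm) monoid_scheme" and I :: "'i set" and \<Lambda> :: "'l set"
    and P :: "'l \<Rightarrow> 'i \<Rightarrow> 'g" and S :: "('i \<times> 'g \<times> 'l) sgroup"
  assumes "group G" and "I \<noteq> {}" and "\<Lambda> \<noteq> {}"
    and "\<And>l i. l \<in> \<Lambda> \<Longrightarrow> i \<in> I \<Longrightarrow> P l i \<in> carrier G"
    and "S = rees_matrix G I \<Lambda> P"
    and "\<exists>x\<in>carrier S. \<exists>y\<in>carrier S. x \<noteq> y"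
  shows "(right_uniform S \<longleftrightarrow>
            (card I = 2 \<and> card \<Lambda> = 1 \<and> trivial_group G) \<or> card I = 1) \<and>
         (right_uniform S \<longleftrightarrow>
            (left_zero_semigroup S \<and> card (carrier S) = 2) \<or> right_group S)"
proof -
  interpret rees G I \<Lambda> P
    by (intro rees.intro rees_axioms.intro) (fact assms)+
  show ?thesis
    unfolding assms(5) by (simp only: right_uniform_iff left_zero_card_2_iff right_group_iff simp_thms)
qed

end
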